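(* Let $\mu:\mathcal{C}\to\mathbb{R}_0^+$ be a fuzzy measure, let $\nu:\mathcal{E}\to\mathbb{R}_0^+$ be a set function with $\nu(\emptyset)=0$, and let $f_1,f_2:S\to\mathbb{R}_0^+$ be $\mu$-measurable functions such that $f_1\le f_2$. If $f_1,f_2\in G_{RL}(\nu,\mu,A)$ for some $A\in\mathcal{C}$, then $$\int_A^{*} f_1\,d(\nu,\mu)\le\int_A^{*} f_2\,d(\nu,\mu).$$
   Context: $\mathbb{R}_0^+=[0,\infty)$. $S$ is a nonempty, at least countable set, $\mathcal{C}$ is a $\sigma$-algebra of subsets of $S$, and $\mathcal{E}$ is a $\sigma$-algebra of subsets of $\mathbb{R}_0^+$ with $\{0\}\in\mathcal{E}$. Set functions on $\mathcal{C}$ and $\mathcal{E}$ have values in $\mathbb{R}_0^+$, vanish on $\emptyset$, and are not assumed additive or monotone unless stated. $\mu$ is a fuzzy measure if $\mu(\emptyset)=0$ and $\mu(B)\le\mu(C)$ whenever $B\subseteq C$, $B,C\in\mathcal{C}$. Measurability: $f:S\to\mathbb{R}_0^+$ is $\mu$-measurable if it is $\mathcal{C}$-measurable, i.e. $E_f^\alpha:=\{s\in S: f(s)\ge\alpha\}\in\mathcal{C}$ for all $\alpha\ge 0$. Riemann-Lebesgue (RL) integral: for two countable partitions $P,P'$ of $\mathbb{R}_0^+$, $P'$ is finer than $P$ if every set of $P'$ is included in some set of $P$. A function $g:\mathbb{R}_0^+\to\mathbb{R}$ is $\nu$-RL integrable if there is $a\in\mathbb{R}$ such that for every $\varepsilon>0$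 there is a countable partition $\Pi_\varepsilon$ of $\mathbb{R}_0^+$ into sets of $\mathcal{E}$ such that for every countable partition $\Pi=(E_n)_n$ of $\mathbb{R}_0^+$ into sets of $\mathcal{E}$ finer than $\Pi_\varepsilon$: $g$ is bounded on every $E_n$ with $\nu(E_n)>0$, and for every choice of $s_n\in E_n$ the series $\sum_n g(s_n)\nu(E_n)$ converges absolutely and $|\sum_n g(s_n)\nu(E_n)-a|<\varepsilon$. Then $a$ is unique and is denoted $(RL)\int_{[0,\infty)}g\,d\nu$. Generalized decomposition integral: for a $\mu$-measurable $f:S\to\mathbb{R}_0^+$ and $A\in\mathcal{C}$ put $u_{f,\mu}^{A}(\alpha)=\mu(E_f^\alpha\cap A)$, $\alpha\ge 0$. $f$ is $(\nu,\mu)$-integrable on $A$ if $u_{f,\mu}^A$ is $\nu$-RL integrable on $\mathbb{R}_0^+$, and then $\int_A^{*}f\,d(\nu,\mu):=(RL)\int_{[0,\infty)}u_{f,\mu}^A\,d\nu$. $G_{RL}(\nu,\mu,A)$ is the set of all $\mu$-measurable $f:S\to\mathbb{R}_0^+$ that are $(\nu,\mu)$-integrable on $A$ (with finite integral). *)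

theory Defs
  imports "HOL-Analysis.Analysis" "HOL-Library.Disjoint_Sets"
begin

text \<open>
  The underlying sets are \<open>S :: 'a set\<close> and \<open>{0..} :: real set\<close>; set functions are total functions
  whose values matter only on the given \<open>\<sigma>\<close>-algebra, and point functions on \<open>S\<close> (on \<open>{0..}\<close>) are
  total functions whose values outside \<open>S\<close> (outside \<open>{0..}\<close>) are never used.
\<close>

definition nonneg_set_function :: "'a set set \<Rightarrow> ('a set \<Rightarrow> real) \<Rightarrow> bool" where
  "nonneg_set_function \<M> \<nu> \<longleftrightarrow> (\<forall>B\<in>\<M>. 0 \<le> \<nu> B) \<and> \<nu> {} = 0"

definition fuzzy_measure :: "'a set set \<Rightarrow> ('a set \<Rightarrow> real) \<Rightarrow> bool" where
  "fuzzy_measure \<C> \<mu> \<longleftrightarrow> nonneg_set_function \<C> \<mu> \<and>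
     (\<forall>B\<in>\<C>. \<forall>C\<in>\<C>. B \<subseteq> C \<longrightarrow> \<mu> B \<le> \<mu> C)"

definition level_set :: "'a set \<Rightarrow> ('a \<Rightarrow> real) \<Rightarrow> real \<Rightarrow> 'a set" where
  "level_set S f \<alpha> = {s\<in>S. f s \<ge> \<alpha>}"

definition mu_measurable :: "'a set \<Rightarrow> 'a set set \<Rightarrow> ('a \<Rightarrow> real) \<Rightarrow> bool" where
  "mu_measurable S \<C> f \<longleftrightarrow> f \<in> S \<rightarrow> {0..} \<and> (\<forall>\<alpha>\<ge>0. level_set S f \<alpha> \<in> \<C>)"

text \<open>
  Countable means finite or countably infinite; \<^const>\<open>partition_on\<close> demands nonempty, pairwise
  disjoint parts.
\<close>

definition countable_partition :: "real set set \<Rightarrow> real set set \<Rightarrow> bool" where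
  "countable_partition \<E> P \<longleftrightarrow> partition_on {0..} P \<and> countable P \<and> P \<subseteq> \<E>"

text \<open>
  A partition is a set of parts, so tags form a function on parts, and the series of an enumeration
  \<open>(E\<^sub>n)\<close> becomes a sum over the set of parts. As absolute convergence is demanded, this does
  not depend on an enumeration.
\<close>

definition has_RL_integral ::
    "real set set \<Rightarrow> (real set \<Rightarrow> real) \<Rightarrow> (real \<Rightarrow> real) \<Rightarrow> real \<Rightarrow> bool" where
  "has_RL_integral \<E> \<nu> g a \<longleftrightarrow>
     (\<forall>\<epsilon>>0. \<exists>P\<^sub>\<epsilon>. countable_partition \<E> P\<^sub>\<epsilon> \<and>
        (\<forall>P. countable_partition \<E> P \<and> refines {0..} P P\<^sub>\<epsilon> \<longrightarrow>
           (\<forall>E\<in>P. \<nu> E > 0 \<longrightarrow> bounded (g ` E)) \<and>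
           (\<forall>s. (\<forall>E\<in>P. s E \<in> E) \<longrightarrow>
              (\<lambda>E. \<bar>g (s E) * \<nu> E\<bar>) summable_on P \<and>
              \<bar>(\<Sum>\<^sub>\<infinity>E\<in>P. g (s E) * \<nu> E) - a\<bar> < \<epsilon>)))"

definition RL_integrable ::
    "real set set \<Rightarrow> (real set \<Rightarrow> real) \<Rightarrow> (real \<Rightarrow> real) \<Rightarrow> bool" where
  "RL_integrable \<E> \<nu> g \<longleftrightarrow> (\<exists>a. has_RL_integral \<E> \<nu> g a)"

definition RL_integral ::
    "real set set \<Rightarrow> (real set \<Rightarrow> real) \<Rightarrow> (real \<Rightarrow> real) \<Rightarrow> real" where
  "RL_integral \<E> \<nu> g = (THE a. has_RL_integral \<E> \<nu> g a)"

definition u_fun :: "'a set \<Rightarrow> ('a set \<Rightarrow> real) \<Rightarrow> 'a set \<Rightarrow> ('a \<Rightarrow> real) \<Rightarrow> real \<Rightarrow> real" where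
  "u_fun S \<mu> A f \<alpha> = \<mu> (level_set S f \<alpha> \<inter> A)"

definition decomp_integrable ::
    "'a set \<Rightarrow> real set set \<Rightarrow> (real set \<Rightarrow> real) \<Rightarrow> ('a set \<Rightarrow> real) \<Rightarrow> 'a set \<Rightarrow> ('a \<Rightarrow> real) \<Rightarrow> bool" where
  "decomp_integrable S \<E> \<nu> \<mu> A f \<longleftrightarrow> RL_integrable \<E> \<nu> (u_fun S \<mu> A f)"

definition decomp_integral ::
    "'a set \<Rightarrow> real set set \<Rightarrow> (real set \<Rightarrow> real) \<Rightarrow> ('a set \<Rightarrow> real) \<Rightarrow> 'a set \<Rightarrow> ('a \<Rightarrow> real) \<Rightarrow> real" where
  "decomp_integral S \<E> \<nu> \<mu> A f = RL_integral \<E> \<nu> (u_fun S \<mu> A f)"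

definition G_RL ::
    "'a set \<Rightarrow> 'a set set \<Rightarrow> real set set \<Rightarrow> (real set \<Rightarrow> real) \<Rightarrow> ('a set \<Rightarrow> real) \<Rightarrow> 'a set \<Rightarrow> ('a \<Rightarrow> real) set" where
  "G_RL S \<C> \<E> \<nu> \<mu> A = {f. mu_measurable S \<C> f \<and> decomp_integrable S \<E> \<nu> \<mu> A f}"

end

theory Submission
  imports Defs
begin

text \<open>
  Two RL integrals can be compared on one partition: a common refinement of the partitions which
  witness integrability of \<open>g\<close> and of \<open>h\<close>, with the same tags for both sums. If
  \<open>g \<le> h\<close> and \<open>\<nu> \<ge> 0\<close>, the sum for \<open>g\<close> is at most that for \<open>h\<close>, so the
  integrals are ordered up to \<open>2\<epsilon>\<close>. This also yields uniqueness of the integral, and it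
  applies because \<open>f\<^sub>1 \<le> f\<^sub>2\<close> makes the level sets of \<open>f\<^sub>1\<close> subsets of those of
  \<open>f\<^sub>2\<close>.
\<close>

text \<open>The parts are the nonempty intersections of a part of \<open>P\<close> with a part of
  \<open>Q\<close>; intersection stability keeps them in \<open>\<E>\<close>.\<close>

lemma countable_partition_common_refinement:
  assumes \<E>: "Int_stable \<E>"
    and P: "countable_partition \<E> P" and Q: "countable_partition \<E> Q"
  obtains R where "countable_partition \<E> R" "refines {0..} R P" "refines {0..} R Q"
proof -
  let ?R = "common_refinement {P, Q}"
  have part: "partition_on {0..} X" if "X \<in> {P, Q}" for X
    using that P Q by (auto simp: countable_partition_def)
  \<comment> \<open>One inclusion suffices: countability and membership in \<open>\<E>\<close> both
    pass to subsets. The right-hand side may also contain the empty set, which a common refinement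
    discards.\<close>
  have sub: "?R \<subseteq> (\<lambda>(X, Y). X \<inter> Y) ` (P \<times> Q)"
    by (auto simp: common_refinement)
  have "countable ?R"
    using P Q by (intro countable_subset[OF sub]) (auto simp: countable_partition_def)
  moreover have "?R \<subseteq> \<E>"
    using sub P Q \<E> by (fastforce simp: countable_partition_def Int_stable_def)
  ultimately have "countable_partition \<E> ?R"
    using partition_on_common_refinement[of "{P, Q}", OF part]
    by (simp add: countable_partition_def)
  then show thesis
    using refines_common_refinement[of "{P, Q}", OF part] by (intro that) blast+
qed

lemma has_RL_integral_mono:
  assumes \<E>: "Int_stable \<E>" and \<nu>: "\<And>E. E \<in> \<E> \<Longrightarrow> 0 \<le> \<nu> E"
    and g: "has_RL_integral \<E> \<nu> g a" and h: "has_RL_integral \<E> \<nu> h b"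
    and le: "\<And>x. 0 \<le> x \<Longrightarrow> g x \<le> h x"
  shows "a \<le> b"
proof (rule field_le_epsilon)
  fix e :: real
  assume "0 < e"
  then have e: "0 < e / 2" by simp
  obtain P where P: "countable_partition \<E> P"
    and gP: "\<And>R s. \<lbrakk>countable_partition \<E> R; refines {0..} R P; \<forall>E\<in>R. s E \<in> E\<rbrakk> \<Longrightarrow>
      (\<lambda>E. \<bar>g (s E) * \<nu> E\<bar>) summable_on R \<and> \<bar>(\<Sum>\<^sub>\<infinity>E\<in>R. g (s E) * \<nu> E) - a\<bar> < e / 2"
    using g e unfolding has_RL_integral_def by meson
  obtain Q where Q: "countable_partition \<E> Q"
    and hQ: "\<And>R s. \<lbrakk>countable_partition \<E> R; refines {0..} R Q; \<forall>E\<in>R. s E \<in> E\<rbrakk> \<Longrightarrow>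
      (\<lambda>E. \<bar>h (s E) * \<nu> E\<bar>) summable_on R \<and> \<bar>(\<Sum>\<^sub>\<infinity>E\<in>R. h (s E) * \<nu> E) - b\<bar> < e / 2"
    using h e unfolding has_RL_integral_def by meson
  obtain R where R: "countable_partition \<E> R" "refines {0..} R P" "refines {0..} R Q"
    using countable_partition_common_refinement[OF \<E> P Q] .
  \<comment> \<open>Parts of a partition are nonempty, so the choice does yield a tag in each
    part.\<close>
  define s where "s E = (SOME x. x \<in> E)" for E :: "real set"
  have s: "\<forall>E\<in>R. s E \<in> E"
    using R(1) by (auto simp: s_def some_in_eq countable_partition_def partition_on_def)
  have "(\<Sum>\<^sub>\<infinity>E\<in>R. g (s E) * \<nu> E) \<le> (\<Sum>\<^sub>\<infinity>E\<in>R. h (s E) * \<nu> E)"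
  proof (rule infsum_mono)
    \<comment> \<open>Termwise comparison of infinite sums needs summability, since a divergent
      \<open>infsum\<close> is 0 by convention; here it comes from absolute convergence.\<close>
    show "(\<lambda>E. g (s E) * \<nu> E) summable_on R" "(\<lambda>E. h (s E) * \<nu> E) summable_on R"
      using gP[OF R(1,2) s] hQ[OF R(1,3) s] by (auto intro: abs_summable_summable)
    fix E assume "E \<in> R"
    \<comment> \<open>Parts lie in \<open>{0..}\<close>, so the tags fall where
      \<open>g \<le> h\<close> is known.\<close>
    then have "E \<in> \<E>" "0 \<le> s E"
      using R(1) s by (auto simp: countable_partition_def partition_on_def)
    then show "g (s E) * \<nu> E \<le> h (s E) * \<nu> E"
      by (intro mult_right_mono le \<nu>)
  qed
  \<comment> \<open>Each sum is within \<open>e / 2\<close> of its integral, so \<open>a\<close> is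
    below the sum for \<open>g\<close> plus \<open>e / 2\<close>, and the sum for \<open>h\<close>
    is below \<open>b + e / 2\<close>.\<close>
  then show "a \<le> b + e"
    using gP[OF R(1,2) s] hQ[OF R(1,3) s] by linarith
qed

text \<open>Uniqueness, needed to evaluate \<open>THE\<close>, is monotonicity applied to
  \<open>g\<close> and itself in both directions.\<close>

lemma RL_integral_eqI:
  assumes "Int_stable \<E>" "\<And>E. E \<in> \<E> \<Longrightarrow> 0 \<le> \<nu> E" "has_RL_integral \<E> \<nu> g a"
  shows "RL_integral \<E> \<nu> g = a"
  unfolding RL_integral_def
  using assms by (intro the_equality antisym) (auto intro: has_RL_integral_mono)

lemma RL_integral_mono:
  assumes "Int_stable \<E>" "\<And>E. E \<in> \<E> \<Longrightarrow> 0 \<le> \<nu> E"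
    and "RL_integrable \<E> \<nu> g" "RL_integrable \<E> \<nu> h"
    and "\<And>x. 0 \<le> x \<Longrightarrow> g x \<le> h x"
  shows "RL_integral \<E> \<nu> g \<le> RL_integral \<E> \<nu> h"
  using assms has_RL_integral_mono[of \<E> \<nu> g _ h]
  by (auto simp: RL_integrable_def RL_integral_eqI)

lemma u_fun_mono:
  assumes "fuzzy_measure \<C> \<mu>" "Int_stable \<C>" "A \<in> \<C>"
    and "mu_measurable S \<C> f" "mu_measurable S \<C> g"
    and "\<And>s. s \<in> S \<Longrightarrow> f s \<le> g s" "0 \<le> \<alpha>"
  shows "u_fun S \<mu> A f \<alpha> \<le> u_fun S \<mu> A g \<alpha>"
proof -
  have "level_set S f \<alpha> \<inter> A \<subseteq> level_set S g \<alpha> \<inter> A"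
    using assms(6) by (force simp: level_set_def)
  \<comment> \<open>\<open>\<mu>\<close> is monotone only on \<open>\<C>\<close>, so the cut level
    sets must be shown to belong to it.\<close>
  moreover have "level_set S f \<alpha> \<inter> A \<in> \<C>" "level_set S g \<alpha> \<inter> A \<in> \<C>"
    using assms by (auto simp: mu_measurable_def intro: Int_stableD)
  ultimately show ?thesis
    using assms(1) by (simp add: fuzzy_measure_def u_fun_def)
qed

theorem theorem3p11:
  fixes S :: "'a set" and \<C> :: "'a set set" and \<E> :: "real set set"
    and \<mu> :: "'a set \<Rightarrow> real" and \<nu> :: "real set \<Rightarrow> real"
    and f\<^sub>1 f\<^sub>2 :: "'a \<Rightarrow> real" and A :: "'a set"
  assumes "infinite S"
    and "sigma_algebra S \<C>"
    and "sigma_algebra {0..} \<E>"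
    and "{0} \<in> \<E>"
    and "fuzzy_measure \<C> \<mu>"
    and "nonneg_set_function \<E> \<nu>"
    and "mu_measurable S \<C> f\<^sub>1"
    and "mu_measurable S \<C> f\<^sub>2"
    and "\<forall>s\<in>S. f\<^sub>1 s \<le> f\<^sub>2 s"
    and "A \<in> \<C>"
    and "f\<^sub>1 \<in> G_RL S \<C> \<E> \<nu> \<mu> A"
    and "f\<^sub>2 \<in> G_RL S \<C> \<E> \<nu> \<mu> A"
  shows "decomp_integral S \<E> \<nu> \<mu> A f\<^sub>1 \<le> decomp_integral S \<E> \<nu> \<mu> A f\<^sub>2"
proof -
  have stable: "Int_stable \<C>" "Int_stable \<E>"
    using assms(2,3) by (auto simp: Int_stable_def sigma_algebra_def algebra_iff_Int)
  show ?thesis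
    unfolding decomp_integral_def
  proof (rule RL_integral_mono[OF stable(2)])
    show "RL_integrable \<E> \<nu> (u_fun S \<mu> A f\<^sub>1)" "RL_integrable \<E> \<nu> (u_fun S \<mu> A f\<^sub>2)"
      using assms(11,12) by (auto simp: G_RL_def decomp_integrable_def)
    show "0 \<le> \<nu> E" if "E \<in> \<E>" for E
      using that assms(6) by (simp add: nonneg_set_function_def)
    show "u_fun S \<mu> A f\<^sub>1 \<alpha> \<le> u_fun S \<mu> A f\<^sub>2 \<alpha>" if "0 \<le> \<alpha>" for \<alpha>
      using that assms(9) by (intro u_fun_mono[OF assms(5) stable(1) assms(10,7,8)]) auto
  qed
qed

end
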